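(* Let $\Delta$ be a simplicial complex, and let $P$ be any one of: skeleton-E, skeleton-mid, skeleton-weakly, skeleton-very-weakly, skeleton-clique. Then $\Delta$ is $P$-chordal if and only if every nonempty induced subcomplex of $\Delta$ has a $P$-simplicial vertex.
   Context: Simplicial complexes are finite and not necessarily pure. A vertex labeling of a complex with $n$ vertices is a bijection of its vertices with $[n]$; $\max f$ is the largest label in $f$; the size of a face is its number of vertices. Two faces of the same dimension $k$ are adjacent if their intersection has dimension $k-1$. A nonempty induced subcomplex consists of all faces of $\Delta$ contained in some nonempty vertex set $W$. $\Delta$ is: - skeleton-E-chordal, if it has a labeling such that for every two faces $f\ne g$ with the same size and same maximum, every $h\subseteq f\cup g$ with $|h|=|f|$ is a face of $\Delta$; - skeleton-mid-chordal, if it has a labeling such that for every two faces $f\neq g$ with the same size $\ge 2$ and same maximum, $\Delta$ contains every $2$-element subset $e$ of $(f\cup g)\setminus\{\max f\}$ and, for each such $e$, some face $h_e$ with $|h_e|=|f|$, $e\subseteq h_e\subseteq (f\cup g)\setminus\{\max f\}$; - skeleton-weakly-chordal, if it has a labeling such that for every two faces $f\ne g$ with the same size and same maximum, $\Delta$ contains some face $h\subseteq(f\cup g)\setminus\{\max f\}$ with $|h|=|f|$; - skeleton-very-weakly-chordal, if it has a labeling such that for every two adjacent faces $f\neq g$ with the same size and same maximum, $(f\cup g)\setminus\{\max f\}\in\Delta$; - skeleton-clique-chordal, if it has a labeling such that for every two faces $f\ne g$ with the same size $\ge2$ and same maximum, every $2$-element subset of $f\cup g$ is a face of $\Delta$.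 A vertex $v$ of a complex $\Gamma$ is: - skeleton-E-simplicial, if for any two faces $f\ne g$ of $\Gamma$ of the same size containing $v$, every subset of $f\cup g$ of size $|f|$ is in $\Gamma$; - skeleton-mid-simplicial, if for any two such faces $\Gamma$ contains each $2$-element subset $e$ of $(f\cup g)\setminus\{v\}$ and, for each such $e$, some face $h_e$ with $|h_e|=|f|$ and $e\subseteq h_e\subseteq(f\cup g)\setminus\{v\}$; - skeleton-weakly-simplicial, if for any two such faces $\Gamma$ contains some face $h\subseteq(f\cup g)\setminus\{v\}$ with $|h|=|f|$; - skeleton-very-weakly-simplicial, if for any two adjacent such faces, $(f\cup g)\setminus\{v\}\in\Gamma$; - skeleton-clique-simplicial, if for any two such faces, $\Gamma$ contains all $2$-element subsets of $f\cup g$. *)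

theory Defs
  imports Main
begin

text \<open>
  An abstract simplicial complex is given by its set of faces. The empty set is a face of every
  complex with at least one face, and neither purity nor the presence of a vertex is required.
\<close>

definition simplicial_complex :: "'a set set \<Rightarrow> bool" where
  "simplicial_complex \<Delta> \<longleftrightarrow>
     finite \<Delta> \<and> (\<forall>f\<in>\<Delta>. finite f) \<and> (\<forall>f\<in>\<Delta>. \<forall>g. g \<subseteq> f \<longrightarrow> g \<in> \<Delta>)"

definition vertices :: "'a set set \<Rightarrow> 'a set" where
  "vertices \<Delta> = {v. {v} \<in> \<Delta>}"

definition induced :: "'a set set \<Rightarrow> 'a set \<Rightarrow> 'a set set" where
  "induced \<Delta> W = {f \<in> \<Delta>. f \<subseteq> W}"

definition face_dim :: "'a set \<Rightarrow> int" where
  "face_dim f = int (card f) - 1"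

definition adjacent :: "'a set \<Rightarrow> 'a set \<Rightarrow> bool" where
  "adjacent f g \<longleftrightarrow> face_dim f = face_dim g \<and> face_dim (f \<inter> g) = face_dim f - 1"

definition labeling :: "'a set set \<Rightarrow> ('a \<Rightarrow> nat) \<Rightarrow> bool" where
  "labeling \<Delta> l \<longleftrightarrow> bij_betw l (vertices \<Delta>) {1..card (vertices \<Delta>)}"

text \<open>
  The label of a vertex is kept apart from the vertex itself. So \<open>max_label l f\<close> is a number, and
  the set \<open>(f \<union> g) \<setminus> {max f}\<close>, where vertices are identified with their labels, becomes
  \<open>{x \<in> f \<union> g. l x \<noteq> max_label l f}\<close>. The maximum is only meaningful for nonempty faces; the empty
  face does no harm below, because two distinct finite sets of the same size are both nonempty.
\<close>

definition max_label :: "('a \<Rightarrow> nat) \<Rightarrow> 'a set \<Rightarrow> nat" where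
  "max_label l f = Max (l ` f)"

definition skeleton_E_chordal :: "'a set set \<Rightarrow> bool" where
  "skeleton_E_chordal \<Delta> \<longleftrightarrow>
     (\<exists>l. labeling \<Delta> l \<and>
       (\<forall>f\<in>\<Delta>. \<forall>g\<in>\<Delta>. f \<noteq> g \<and> card f = card g \<and> max_label l f = max_label l g \<longrightarrow>
         (\<forall>h. h \<subseteq> f \<union> g \<and> card h = card f \<longrightarrow> h \<in> \<Delta>)))"

definition skeleton_mid_chordal :: "'a set set \<Rightarrow> bool" where
  "skeleton_mid_chordal \<Delta> \<longleftrightarrow>
     (\<exists>l. labeling \<Delta> l \<and>
       (\<forall>f\<in>\<Delta>. \<forall>g\<in>\<Delta>.
         f \<noteq> g \<and> card f = card g \<and> card f \<ge> 2 \<and> max_label l f = max_label l g \<longrightarrow>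
         (\<forall>e. e \<subseteq> {x \<in> f \<union> g. l x \<noteq> max_label l f} \<and> card e = 2 \<longrightarrow>
           e \<in> \<Delta> \<and>
           (\<exists>h\<in>\<Delta>. card h = card f \<and> e \<subseteq> h \<and> h \<subseteq> {x \<in> f \<union> g. l x \<noteq> max_label l f}))))"

definition skeleton_weakly_chordal :: "'a set set \<Rightarrow> bool" where
  "skeleton_weakly_chordal \<Delta> \<longleftrightarrow>
     (\<exists>l. labeling \<Delta> l \<and>
       (\<forall>f\<in>\<Delta>. \<forall>g\<in>\<Delta>. f \<noteq> g \<and> card f = card g \<and> max_label l f = max_label l g \<longrightarrow>
         (\<exists>h\<in>\<Delta>. h \<subseteq> {x \<in> f \<union> g. l x \<noteq> max_label l f} \<and> card h = card f)))"

definition skeleton_very_weakly_chordal :: "'a set set \<Rightarrow> bool" where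
  "skeleton_very_weakly_chordal \<Delta> \<longleftrightarrow>
     (\<exists>l. labeling \<Delta> l \<and>
       (\<forall>f\<in>\<Delta>. \<forall>g\<in>\<Delta>.
         adjacent f g \<and> f \<noteq> g \<and> card f = card g \<and> max_label l f = max_label l g \<longrightarrow>
         {x \<in> f \<union> g. l x \<noteq> max_label l f} \<in> \<Delta>))"

definition skeleton_clique_chordal :: "'a set set \<Rightarrow> bool" where
  "skeleton_clique_chordal \<Delta> \<longleftrightarrow>
     (\<exists>l. labeling \<Delta> l \<and>
       (\<forall>f\<in>\<Delta>. \<forall>g\<in>\<Delta>.
         f \<noteq> g \<and> card f = card g \<and> card f \<ge> 2 \<and> max_label l f = max_label l g \<longrightarrow>
         (\<forall>e. e \<subseteq> f \<union> g \<and> card e = 2 \<longrightarrow> e \<in> \<Delta>)))"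

definition skeleton_E_simplicial :: "'a set set \<Rightarrow> 'a \<Rightarrow> bool" where
  "skeleton_E_simplicial \<Gamma> v \<longleftrightarrow>
     (\<forall>f\<in>\<Gamma>. \<forall>g\<in>\<Gamma>. f \<noteq> g \<and> card f = card g \<and> v \<in> f \<and> v \<in> g \<longrightarrow>
       (\<forall>h. h \<subseteq> f \<union> g \<and> card h = card f \<longrightarrow> h \<in> \<Gamma>))"

definition skeleton_mid_simplicial :: "'a set set \<Rightarrow> 'a \<Rightarrow> bool" where
  "skeleton_mid_simplicial \<Gamma> v \<longleftrightarrow>
     (\<forall>f\<in>\<Gamma>. \<forall>g\<in>\<Gamma>. f \<noteq> g \<and> card f = card g \<and> v \<in> f \<and> v \<in> g \<longrightarrow>
       (\<forall>e. e \<subseteq> (f \<union> g) - {v} \<and> card e = 2 \<longrightarrow>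
         e \<in> \<Gamma> \<and> (\<exists>h\<in>\<Gamma>. card h = card f \<and> e \<subseteq> h \<and> h \<subseteq> (f \<union> g) - {v})))"

definition skeleton_weakly_simplicial :: "'a set set \<Rightarrow> 'a \<Rightarrow> bool" where
  "skeleton_weakly_simplicial \<Gamma> v \<longleftrightarrow>
     (\<forall>f\<in>\<Gamma>. \<forall>g\<in>\<Gamma>. f \<noteq> g \<and> card f = card g \<and> v \<in> f \<and> v \<in> g \<longrightarrow>
       (\<exists>h\<in>\<Gamma>. h \<subseteq> (f \<union> g) - {v} \<and> card h = card f))"

definition skeleton_very_weakly_simplicial :: "'a set set \<Rightarrow> 'a \<Rightarrow> bool" where
  "skeleton_very_weakly_simplicial \<Gamma> v \<longleftrightarrow>
     (\<forall>f\<in>\<Gamma>. \<forall>g\<in>\<Gamma>. adjacent f g \<and> f \<noteq> g \<and> card f = card g \<and> v \<in> f \<and> v \<in> g \<longrightarrow>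
       (f \<union> g) - {v} \<in> \<Gamma>)"

definition skeleton_clique_simplicial :: "'a set set \<Rightarrow> 'a \<Rightarrow> bool" where
  "skeleton_clique_simplicial \<Gamma> v \<longleftrightarrow>
     (\<forall>f\<in>\<Gamma>. \<forall>g\<in>\<Gamma>. f \<noteq> g \<and> card f = card g \<and> v \<in> f \<and> v \<in> g \<longrightarrow>
       (\<forall>e. e \<subseteq> f \<union> g \<and> card e = 2 \<longrightarrow> e \<in> \<Gamma>))"

end

theory Submission
  imports Defs
begin

text \<open>
  Every one of the five conditions on a pair of faces \<open>f\<close>, \<open>g\<close> with a common vertex \<open>v\<close> only asks for
  faces inside \<open>f \<union> g\<close>. Hence it is the same in \<open>\<Delta>\<close> and in any induced subcomplex containing \<open>f\<close> and
  \<open>g\<close>, and simpliciality of \<open>v\<close> is inherited by smaller induced subcomplexes. A labeling witnesses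
  chordality iff every vertex is simplicial in the subcomplex induced on the vertices of at most
  its own label, so chordality is the existence of an elimination order: the vertex of maximal
  label in \<open>W\<close> is simplicial there, and conversely removing simplicial vertices one at a time
  produces the labels in decreasing order.
\<close>

section \<open>Elimination orders of a finite set\<close>

text \<open>Induction on the size of the set: a vertex good in the whole set takes the top label,
  and the others are labelled recursively. Later \<open>P v W\<close> becomes simpliciality of
  \<open>v\<close> in the subcomplex induced on \<open>W\<close>.\<close>

lemma elimination_order:
  fixes P :: "'a \<Rightarrow> 'a set \<Rightarrow> bool"
  assumes "finite V"
    and antimono: "\<And>v U W. U \<subseteq> W \<Longrightarrow> W \<subseteq> V \<Longrightarrow> P v W \<Longrightarrow> P v U"
    and ex: "\<And>W. W \<noteq> {} \<Longrightarrow> W \<subseteq> V \<Longrightarrow> \<exists>v\<in>W. P v W"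
  shows "\<exists>l::'a \<Rightarrow> nat. bij_betw l V {1..card V} \<and> (\<forall>v\<in>V. P v {x \<in> V. l x \<le> l v})"
proof -
  \<comment> \<open>Generalized from \<open>V\<close> to its subsets, so that the induction can pass
    from \<open>W\<close> to \<open>W - {v}\<close>.\<close>
  have "\<exists>l::'a \<Rightarrow> nat. bij_betw l W {1..card W} \<and> (\<forall>v\<in>W. P v {x \<in> W. l x \<le> l v})"
    if "card W = n" "W \<subseteq> V" for W n
    using that
  proof (induction n arbitrary: W)
    case 0
    then have "W = {}"
      using \<open>finite V\<close> finite_subset by fastforce
    then show ?case
      by (simp add: bij_betw_def)
  next
    case (Suc n)
    have "finite W"
      using Suc.prems(2) \<open>finite V\<close> by (rule finite_subset)
    have "W \<noteq> {}"
      using Suc.prems(1) by auto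
    then obtain v where v: "v \<in> W" "P v W"
      using ex Suc.prems(2) by blast
    define U where "U = W - {v}"
    have W: "W = insert v U" "v \<notin> U" "card U = n" "U \<subseteq> V"
      using v Suc.prems by (auto simp: U_def)
    obtain l :: "'a \<Rightarrow> nat" where l: "bij_betw l U {1..n}" "\<forall>u\<in>U. P u {x \<in> U. l x \<le> l u}"
      using Suc.IH[OF W(3,4)] W(3) by auto
    define m where "m = l(v := Suc n)"
    have m_v: "m v = Suc n"
      by (simp add: m_def)
    have m_U: "m x = l x" if "x \<in> U" for x
      using that W(2) by (auto simp: m_def)
    have l_le: "l x \<le> n" if "x \<in> U" for x
      using bij_betwE[OF l(1)] that by auto
    have "bij_betw m U {1..n}"
      using l(1) m_U by (simp cong: bij_betw_cong)
    moreover have "{1..Suc n} = insert (Suc n) {1..n}"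
      by auto
    ultimately have "bij_betw m W {1..card W}"
      using notIn_Un_bij_betw[of v U m "{1..n}"] W Suc.prems(1) m_v by simp
    moreover have "P u {x \<in> W. m x \<le> m u}" if "u \<in> W" for u
    proof (cases "u = v")
      case True
      then show ?thesis
        using antimono[of "{x \<in> W. m x \<le> m u}" W v] v(2) Suc.prems(2) by auto
    next
      case False
      then have u: "u \<in> U"
        using that W(1) by simp
      \<comment> \<open>The label \<open>Suc n\<close> of \<open>v\<close> exceeds all labels on
        \<open>U\<close>, so \<open>v\<close> does not enter the initial segments of the remaining
        vertices.\<close>
      have "{x \<in> W. m x \<le> m u} = {x \<in> U. l x \<le> l u}"
        using W(1) m_U m_v l_le[OF u] u by auto
      then show ?thesis
        using l(2) u by simp
    qed
    ultimately show ?case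
      by blast
  qed
  then show ?thesis
    by blast
qed

section \<open>Induced subcomplexes and finiteness\<close>

lemma induced_subset: "induced \<Delta> W \<subseteq> \<Delta>"
  by (auto simp: induced_def)

lemma induced_mono: "U \<subseteq> W \<Longrightarrow> induced \<Delta> U \<subseteq> induced \<Delta> W"
  by (auto simp: induced_def)

lemma vertices_induced: "W \<subseteq> vertices \<Delta> \<Longrightarrow> vertices (induced \<Delta> W) = W"
  by (auto simp: vertices_def induced_def)

lemma face_subset_vertices:
  assumes "simplicial_complex \<Delta>" "f \<in> \<Delta>"
  shows "f \<subseteq> vertices \<Delta>"
proof
  fix x assume "x \<in> f"
  then have "{x} \<subseteq> f"
    by simp
  then show "x \<in> vertices \<Delta>"
    using assms unfolding simplicial_complex_def vertices_def by blast
qed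

lemma finite_face: "simplicial_complex \<Delta> \<Longrightarrow> f \<in> \<Delta> \<Longrightarrow> finite f"
  by (simp add: simplicial_complex_def)

lemma finite_vertices:
  assumes "simplicial_complex \<Delta>"
  shows "finite (vertices \<Delta>)"
proof -
  have "vertices \<Delta> \<subseteq> \<Union>\<Delta>"
    by (auto simp: vertices_def)
  moreover have "finite (\<Union>\<Delta>)"
    using assms by (auto simp: simplicial_complex_def)
  ultimately show ?thesis
    by (rule finite_subset)
qed

section \<open>Maximal labels and common vertices\<close>

lemma max_label_eqI:
  assumes "finite f" "v \<in> f" "\<And>x. x \<in> f \<Longrightarrow> l x \<le> l v"
  shows "max_label l f = l v"
  unfolding max_label_def using assms by (intro Max_eqI) auto

lemma ex_max_label:
  assumes "finite f" "f \<noteq> {}"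
  obtains v where "v \<in> f" "max_label l f = l v" "\<And>x. x \<in> f \<Longrightarrow> l x \<le> l v"
proof -
  have "Max (l ` f) \<in> l ` f"
    using assms by (intro Max_in) auto
  then obtain v where "v \<in> f" "max_label l f = l v"
    by (auto simp: max_label_def)
  moreover from this have "l x \<le> l v" if "x \<in> f" for x
    using that assms(1) unfolding max_label_def by (metis Max_ge finite_imageI imageI)
  ultimately show ?thesis
    using that by blast
qed

text \<open>By injectivity of \<open>l\<close>, two faces share their maximal label iff they share
  the vertex \<open>v\<close> carrying it, and then both lie in the segment of labels up to
  \<open>l v\<close>. The predicate \<open>Q\<close> is left abstract to serve all five notions; its
  third argument is the union without the top vertex.\<close>

lemma labeling_condition_iff:
  assumes \<Delta>: "simplicial_complex \<Delta>" and l: "labeling \<Delta> l"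
  shows "(\<forall>f\<in>\<Delta>. \<forall>g\<in>\<Delta>. f \<noteq> g \<and> card f = card g \<and> max_label l f = max_label l g \<longrightarrow>
             Q f g {x \<in> f \<union> g. l x \<noteq> max_label l f}) \<longleftrightarrow>
         (\<forall>v\<in>vertices \<Delta>. \<forall>f\<in>induced \<Delta> {x \<in> vertices \<Delta>. l x \<le> l v}.
            \<forall>g\<in>induced \<Delta> {x \<in> vertices \<Delta>. l x \<le> l v}.
            f \<noteq> g \<and> card f = card g \<and> v \<in> f \<and> v \<in> g \<longrightarrow> Q f g (f \<union> g - {v}))"
    (is "?L \<longleftrightarrow> ?R")
proof -
  have inj: "inj_on l (vertices \<Delta>)"
    using l by (simp add: labeling_def bij_betw_def)
  have diff: "{x \<in> f \<union> g. l x \<noteq> l v} = f \<union> g - {v}"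
    if "f \<in> \<Delta>" "g \<in> \<Delta>" "v \<in> vertices \<Delta>" for f g v
    using face_subset_vertices[OF \<Delta>] that inj_on_eq_iff[OF inj] by blast
  show ?thesis
  proof
    assume L: ?L
    show ?R
    proof (intro ballI impI)
      fix v f g
      assume v: "v \<in> vertices \<Delta>"
        and "f \<in> induced \<Delta> {x \<in> vertices \<Delta>. l x \<le> l v}" "g \<in> induced \<Delta> {x \<in> vertices \<Delta>. l x \<le> l v}"
        and fg: "f \<noteq> g \<and> card f = card g \<and> v \<in> f \<and> v \<in> g"
      then have f: "f \<in> \<Delta>" "\<And>x. x \<in> f \<Longrightarrow> l x \<le> l v" and g: "g \<in> \<Delta>" "\<And>x. x \<in> g \<Longrightarrow> l x \<le> l v"
        by (auto simp: induced_def)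
      have "max_label l f = l v" "max_label l g = l v"
        using f g fg finite_face[OF \<Delta>] by (auto intro!: max_label_eqI)
      then show "Q f g (f \<union> g - {v})"
        using L f(1) g(1) fg diff[OF f(1) g(1) v] by metis
    qed
  next
    assume R: ?R
    show ?L
    proof (intro ballI impI)
      fix f g
      assume f: "f \<in> \<Delta>" and g: "g \<in> \<Delta>"
        and fg: "f \<noteq> g \<and> card f = card g \<and> max_label l f = max_label l g"
      have fin: "finite f" "finite g"
        using f g finite_face[OF \<Delta>] by auto
      \<comment> \<open>Were one face empty, equal size and finiteness would make the other empty
        too, against \<open>f \<noteq> g\<close>.\<close>
      then have ne: "f \<noteq> {}" "g \<noteq> {}"
        using fg by auto
      obtain v where v: "v \<in> f" "max_label l f = l v" "\<And>x. x \<in> f \<Longrightarrow> l x \<le> l v"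
        using ex_max_label[OF fin(1) ne(1)] by blast
      obtain w where w: "w \<in> g" "max_label l g = l w" "\<And>x. x \<in> g \<Longrightarrow> l x \<le> l w"
        using ex_max_label[OF fin(2) ne(2)] by blast
      have sub: "f \<subseteq> vertices \<Delta>" "g \<subseteq> vertices \<Delta>"
        using f g face_subset_vertices[OF \<Delta>] by auto
      have "w = v"
        using inj_onD[OF inj, of w v] fg v w sub by auto
      then have "f \<in> induced \<Delta> {x \<in> vertices \<Delta>. l x \<le> l v}"
        "g \<in> induced \<Delta> {x \<in> vertices \<Delta>. l x \<le> l v}"
        using f g v w sub by (auto simp: induced_def)
      then have "Q f g (f \<union> g - {v})"
        using bspec[OF R, of v] fg v(1) w(1) sub(1) \<open>w = v\<close> by auto
      then show "Q f g {x \<in> f \<union> g. l x \<noteq> max_label l f}"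
        using diff[OF f g] v sub by auto
    qed
  qed
qed

section \<open>The equivalence for an abstract local condition\<close>

text \<open>In \<open>Q \<Gamma> f g D\<close>, \<open>\<Gamma>\<close> is the complex in which
  faces are sought and \<open>D\<close> is the union without the top vertex. The premise
  \<open>local\<close> says that only faces inside \<open>f \<union> g\<close> matter. The premise
  \<open>simplicial\<close> is confined to \<open>\<Gamma> \<subseteq> \<Delta>\<close>, which makes
  the faces of \<open>\<Gamma>\<close> finite.\<close>

lemma chordal_iff_simplicial:
  assumes \<Delta>: "simplicial_complex \<Delta>"
    and local: "\<And>W f g v. f \<union> g \<subseteq> W \<Longrightarrow>
      Q (induced \<Delta> W) f g (f \<union> g - {v}) \<longleftrightarrow> Q \<Delta> f g (f \<union> g - {v})"
    and chordal: "C \<longleftrightarrow> (\<exists>l. labeling \<Delta> l \<and>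
      (\<forall>f\<in>\<Delta>. \<forall>g\<in>\<Delta>. f \<noteq> g \<and> card f = card g \<and> max_label l f = max_label l g \<longrightarrow>
         Q \<Delta> f g {x \<in> f \<union> g. l x \<noteq> max_label l f}))"
    and simplicial: "\<And>\<Gamma> v. \<Gamma> \<subseteq> \<Delta> \<Longrightarrow> S \<Gamma> v \<longleftrightarrow>
      (\<forall>f\<in>\<Gamma>. \<forall>g\<in>\<Gamma>. f \<noteq> g \<and> card f = card g \<and> v \<in> f \<and> v \<in> g \<longrightarrow> Q \<Gamma> f g (f \<union> g - {v}))"
  shows "C \<longleftrightarrow> (\<forall>W. W \<noteq> {} \<and> W \<subseteq> vertices \<Delta> \<longrightarrow>
    (\<exists>v\<in>vertices (induced \<Delta> W). S (induced \<Delta> W) v))"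
proof -
  let ?V = "vertices \<Delta>"
  \<comment> \<open>With \<open>Q\<close> evaluated in \<open>\<Delta>\<close>, the set
    \<open>W\<close> only restricts the pairs to be tested; shrinking \<open>W\<close> leaves fewer
    pairs, which gives \<open>antimono\<close>.\<close>
  have S: "S (induced \<Delta> W) v \<longleftrightarrow> (\<forall>f\<in>induced \<Delta> W. \<forall>g\<in>induced \<Delta> W.
      f \<noteq> g \<and> card f = card g \<and> v \<in> f \<and> v \<in> g \<longrightarrow> Q \<Delta> f g (f \<union> g - {v}))" for W v
  proof -
    have "Q (induced \<Delta> W) f g (f \<union> g - {v}) \<longleftrightarrow> Q \<Delta> f g (f \<union> g - {v})"
      if "f \<in> induced \<Delta> W" "g \<in> induced \<Delta> W" for f g
      using that by (intro local) (auto simp: induced_def)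
    then show ?thesis
      unfolding simplicial[OF induced_subset] by blast
  qed
  have antimono: "S (induced \<Delta> U) v" if "U \<subseteq> W" "S (induced \<Delta> W) v" for U W v
    using that(2) induced_mono[OF that(1), of \<Delta>] unfolding S by blast
  have C: "C \<longleftrightarrow> (\<exists>l. labeling \<Delta> l \<and> (\<forall>v\<in>?V. S (induced \<Delta> {x \<in> ?V. l x \<le> l v}) v))"
    unfolding chordal S
    by (intro ex_cong1 conj_cong refl labeling_condition_iff[OF \<Delta>, where Q = "Q \<Delta>"])
  have "C \<longleftrightarrow> (\<forall>W. W \<noteq> {} \<and> W \<subseteq> ?V \<longrightarrow> (\<exists>v\<in>W. S (induced \<Delta> W) v))"
  proof
    assume C
    then obtain l :: "'a \<Rightarrow> nat" where l: "\<forall>v\<in>?V. S (induced \<Delta> {x \<in> ?V. l x \<le> l v}) v"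
      unfolding C by blast
    show "\<forall>W. W \<noteq> {} \<and> W \<subseteq> ?V \<longrightarrow> (\<exists>v\<in>W. S (induced \<Delta> W) v)"
    proof (intro allI impI)
      fix W assume W: "W \<noteq> {} \<and> W \<subseteq> ?V"
      then have "finite W" "W \<noteq> {}"
        using finite_vertices[OF \<Delta>] finite_subset by auto
      \<comment> \<open>The vertex of largest label in \<open>W\<close>: it is simplicial in the
        segment up to its label, and that segment contains \<open>W\<close>.\<close>
      then obtain v where v: "v \<in> W" "\<And>x. x \<in> W \<Longrightarrow> l x \<le> l v"
        using ex_max_label[of W l] by metis
      then have "W \<subseteq> {x \<in> ?V. l x \<le> l v}"
        using W by blast
      then show "\<exists>v\<in>W. S (induced \<Delta> W) v"
        using antimono[of W "{x \<in> ?V. l x \<le> l v}" v] l v(1) W by auto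
    qed
  next
    assume R: "\<forall>W. W \<noteq> {} \<and> W \<subseteq> ?V \<longrightarrow> (\<exists>v\<in>W. S (induced \<Delta> W) v)"
    show C
      unfolding C labeling_def
    proof (rule elimination_order[OF finite_vertices[OF \<Delta>], where P = "\<lambda>v W. S (induced \<Delta> W) v"])
      show "S (induced \<Delta> U) v" if "U \<subseteq> W" "S (induced \<Delta> W) v" for v U W
        using that by (rule antimono)
      show "\<exists>v\<in>W. S (induced \<Delta> W) v" if "W \<noteq> {}" "W \<subseteq> ?V" for W
        using R that by blast
    qed
  qed
  then show ?thesis
    by (auto simp: vertices_induced)
qed

section \<open>The five notions as instances\<close>

text \<open>Singletons with a common element coincide. This reconciles the mid and clique
  definitions, where chordality demands size at least 2 and simpliciality does not.\<close>

lemma two_le_card_if_common_element: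
  assumes "finite f" "finite g" "f \<noteq> g" "card f = card g" "v \<in> f" "v \<in> g"
  shows "2 \<le> card f"
proof (rule ccontr)
  assume "\<not> 2 \<le> card f"
  then have "card f = 1"
    using assms(1,5) card_gt_0_iff[of f] by auto
  then show False
    using assms by (metis card_1_singletonE singletonD)
qed

theorem theorem50:
  fixes \<Delta> :: "'a set set"
  assumes "simplicial_complex \<Delta>"
  shows "(skeleton_E_chordal \<Delta> \<longleftrightarrow>
       (\<forall>W. W \<noteq> {} \<and> W \<subseteq> vertices \<Delta> \<longrightarrow>
         (\<exists>v\<in>vertices (induced \<Delta> W). skeleton_E_simplicial (induced \<Delta> W) v))) \<and>
    (skeleton_mid_chordal \<Delta> \<longleftrightarrow>
       (\<forall>W. W \<noteq> {} \<and> W \<subseteq> vertices \<Delta> \<longrightarrow>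
         (\<exists>v\<in>vertices (induced \<Delta> W). skeleton_mid_simplicial (induced \<Delta> W) v))) \<and>
    (skeleton_weakly_chordal \<Delta> \<longleftrightarrow>
       (\<forall>W. W \<noteq> {} \<and> W \<subseteq> vertices \<Delta> \<longrightarrow>
         (\<exists>v\<in>vertices (induced \<Delta> W). skeleton_weakly_simplicial (induced \<Delta> W) v))) \<and>
    (skeleton_very_weakly_chordal \<Delta> \<longleftrightarrow>
       (\<forall>W. W \<noteq> {} \<and> W \<subseteq> vertices \<Delta> \<longrightarrow>
         (\<exists>v\<in>vertices (induced \<Delta> W). skeleton_very_weakly_simplicial (induced \<Delta> W) v))) \<and>
    (skeleton_clique_chordal \<Delta> \<longleftrightarrow>
       (\<forall>W. W \<noteq> {} \<and> W \<subseteq> vertices \<Delta> \<longrightarrow>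
         (\<exists>v\<in>vertices (induced \<Delta> W). skeleton_clique_simplicial (induced \<Delta> W) v)))"
proof (intro conjI)
  have two: "2 \<le> card f"
    if "\<Gamma> \<subseteq> \<Delta>" "f \<in> \<Gamma>" "g \<in> \<Gamma>" "f \<noteq> g" "card f = card g" "v \<in> f" "v \<in> g" for \<Gamma> f g v
    using that finite_face[OF assms] by (intro two_le_card_if_common_element[of f g v]) auto
  show "skeleton_E_chordal \<Delta> \<longleftrightarrow> (\<forall>W. W \<noteq> {} \<and> W \<subseteq> vertices \<Delta> \<longrightarrow>
      (\<exists>v\<in>vertices (induced \<Delta> W). skeleton_E_simplicial (induced \<Delta> W) v))"
  \<comment> \<open>The third argument is ignored because the E-condition keeps the top vertex in
    the union.\<close>
  proof (rule chordal_iff_simplicial[OF assms, where Q =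
        "\<lambda>\<Gamma> f g _. \<forall>h. h \<subseteq> f \<union> g \<and> card h = card f \<longrightarrow> h \<in> \<Gamma>"],
      goal_cases local chordal simplicial)
    case (local W f g v)
    then show ?case
      by (auto simp: induced_def)
  next
    case chordal
    show ?case
      unfolding skeleton_E_chordal_def by (rule refl)
  next
    case (simplicial \<Gamma> v)
    show ?case
      unfolding skeleton_E_simplicial_def by (rule refl)
  qed
  show "skeleton_mid_chordal \<Delta> \<longleftrightarrow> (\<forall>W. W \<noteq> {} \<and> W \<subseteq> vertices \<Delta> \<longrightarrow>
      (\<exists>v\<in>vertices (induced \<Delta> W). skeleton_mid_simplicial (induced \<Delta> W) v))"
  \<comment> \<open>The size bound moves into \<open>Q\<close>; on the simplicial side
    \<open>two\<close> discharges it.\<close>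
  proof (rule chordal_iff_simplicial[OF assms, where Q =
        "\<lambda>\<Gamma> f g D. 2 \<le> card f \<longrightarrow> (\<forall>e. e \<subseteq> D \<and> card e = 2 \<longrightarrow>
          e \<in> \<Gamma> \<and> (\<exists>h\<in>\<Gamma>. card h = card f \<and> e \<subseteq> h \<and> h \<subseteq> D))"],
      goal_cases local chordal simplicial)
    case (local W f g v)
    have "h \<in> induced \<Delta> W \<longleftrightarrow> h \<in> \<Delta>" if "h \<subseteq> f \<union> g - {v}" for h
      using that local by (auto simp: induced_def)
    then show ?case
      by (intro imp_cong refl all_cong1) metis
  next
    case chordal
    show ?case
      unfolding skeleton_mid_chordal_def by (intro ex_cong1 conj_cong ball_cong refl) blast
  next
    case (simplicial \<Gamma> v)
    show ?case
      unfolding skeleton_mid_simplicial_def using two[OF simplicial] by (intro ball_cong refl) blast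
  qed
  show "skeleton_weakly_chordal \<Delta> \<longleftrightarrow> (\<forall>W. W \<noteq> {} \<and> W \<subseteq> vertices \<Delta> \<longrightarrow>
      (\<exists>v\<in>vertices (induced \<Delta> W). skeleton_weakly_simplicial (induced \<Delta> W) v))"
  proof (rule chordal_iff_simplicial[OF assms, where Q =
        "\<lambda>\<Gamma> f g D. \<exists>h\<in>\<Gamma>. h \<subseteq> D \<and> card h = card f"],
      goal_cases local chordal simplicial)
    case (local W f g v)
    then show ?case
      by (auto simp: induced_def)
  next
    case chordal
    show ?case
      unfolding skeleton_weakly_chordal_def by (rule refl)
  next
    case (simplicial \<Gamma> v)
    show ?case
      unfolding skeleton_weakly_simplicial_def by (rule refl)
  qed
  show "skeleton_very_weakly_chordal \<Delta> \<longleftrightarrow> (\<forall>W. W \<noteq> {} \<and> W \<subseteq> vertices \<Delta> \<longrightarrow>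
      (\<exists>v\<in>vertices (induced \<Delta> W). skeleton_very_weakly_simplicial (induced \<Delta> W) v))"
  \<comment> \<open>Adjacency does not refer to the complex, so it can be a premise inside
    \<open>Q\<close> without harming locality.\<close>
  proof (rule chordal_iff_simplicial[OF assms, where Q =
        "\<lambda>\<Gamma> f g D. adjacent f g \<longrightarrow> D \<in> \<Gamma>"],
      goal_cases local chordal simplicial)
    case (local W f g v)
    then show ?case
      by (auto simp: induced_def)
  next
    case chordal
    show ?case
      unfolding skeleton_very_weakly_chordal_def by (intro ex_cong1 conj_cong ball_cong refl) blast
  next
    case (simplicial \<Gamma> v)
    show ?case
      unfolding skeleton_very_weakly_simplicial_def by (intro ball_cong refl) blast
  qed
  show "skeleton_clique_chordal \<Delta> \<longleftrightarrow> (\<forall>W. W \<noteq> {} \<and> W \<subseteq> vertices \<Delta> \<longrightarrow>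
      (\<exists>v\<in>vertices (induced \<Delta> W). skeleton_clique_simplicial (induced \<Delta> W) v))"
  proof (rule chordal_iff_simplicial[OF assms, where Q =
        "\<lambda>\<Gamma> f g _. 2 \<le> card f \<longrightarrow> (\<forall>e. e \<subseteq> f \<union> g \<and> card e = 2 \<longrightarrow> e \<in> \<Gamma>)"],
      goal_cases local chordal simplicial)
    case (local W f g v)
    then show ?case
      by (auto simp: induced_def)
  next
    case chordal
    show ?case
      unfolding skeleton_clique_chordal_def by (intro ex_cong1 conj_cong ball_cong refl) blast
  next
    case (simplicial \<Gamma> v)
    show ?case
      unfolding skeleton_clique_simplicial_def using two[OF simplicial] by (intro ball_cong refl) blast
  qed
qed

end
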